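(* Let $C\subseteq K$ be a Cartesian effect category with semi-pure products $\ltimes,\rtimes$. For all objects $X,Y$ put $A(X,Y)=K(X,Y)$; let $\mathtt{arr}:C(X,Y)\to A(X,Y)$ be the inclusion $C(X,Y)\subseteq K(X,Y)$; for $f\in A(X,Y)$ and $g\in A(Y,Z)$ let $f>\!\!>\!\!>g=g\circ f\in A(X,Z)$; and for $f\in A(X,Y)$ and an object $Z$ let $\mathtt{first}\,f=f\rtimes\mathrm{id}_Z\in A(X\times Z,Y\times Z)$. Then $A$ with these operations is an Arrow on $C$.
   Context: **Cartesian effect categories.** A subcategory $C$ of a category $K$ is wide if it has the same objects as $K$; morphisms of $K$ lying in $C$ are called pure. A pure terminal object is an object $1$ that is terminal in $C$, and $\langle\,\rangle_X:X\to 1$ denotes the unique pure morphism. The effect of $f:X\to Y$ in $K$ is $\mathcal{E}(f)=\langle\,\rangle_Y\circ f$; for $f:X\to Y$ and $f':X\to Y'$, write $f\approx f'$ iff $\mathcal{E}(f)=\mathcal{E}(f')$. A consistency relation $\lhd$ is a relation between parallel morphisms of $K$, the second one being pure, such that (i) $v\lhd v$ for every pure $v$; (ii) for all $f:X\to Y$, $g:Y\to Z$ in $K$ and all pure $u:Y\to Y'$, $v:X\to Y'$, $w:Y'\to Z$, if $u\circ f\lhd v$ and $g\lhd w\circ u$ then $g\circ f\lhd w\circ v$. Write $f\lhd\rhd f'$ iff there is a pure $v$ with $f\lhd v$ and $f'\lhd v$. An effect category consists of a category $K$, a wide subcategory $C$, a pure terminal object $1$ and a consistency relation $\lhd$ satisfying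 complementarity: for parallel $f,f'$, if $f\approx f'$ and $f\lhd\rhd f'$ then $f=f'$. A Cartesian effect category is an effect category in which $C$ has chosen finite products (terminal object $1$, binary products $\times$), together with two graph homomorphisms $\ltimes:C\times K\to K$ and $\rtimes:K\times C\to K$ (the semi-pure products), sending $(X_1,X_2)$ to $X_1\times X_2$ on objects, both extending $\times$ on pairs of pure morphisms, and such that, with projections $p_i:X_1\times X_2\to X_i$ and $q_i:Y_1\times Y_2\to Y_i$: for all pure $v_1:X_1\to Y_1$ and all $f_2:X_2\to Y_2$ in $K$, $v_1\ltimes f_2:X_1\times X_2\to Y_1\times Y_2$ is the unique morphism of $K$ with $q_1\circ(v_1\ltimes f_2)\lhd v_1\circ p_1$ and $q_2\circ(v_1\ltimes f_2)=f_2\circ p_2$; and for all $f_1:X_1\to Y_1$ in $K$ and all pure $v_2:X_2\to Y_2$, $f_1\rtimes v_2$ is the unique morphism of $K$ with $q_1\circ(f_1\rtimes v_2)=f_1\circ p_1$ and $q_2\circ(f_1\rtimes v_2)\lhd v_2\circ p_2$. **Arrows.** For a Cartesian category $C$ (chosen finite products), an Arrow $A$ on $C$ associates to all objects $X,Y$ of $C$ a set $A(X,Y)$, together with operations $\mathtt{arr}:C(X,Y)\to A(X,Y)$, $(>\!\!>\!\!>):A(X,Y)\to A(Y,Z)\to A(X,Z)$ and $\mathtt{first}:A(X,Y)\to A(X\times Z,Y\times Z)$ (for all objects $X,Y,Z$) satisfying, whenever the expressions make sense ($f,g,h$ in $A$; $v,w$ in $C$): (1) $\mathtt{arr}\,\mathrm{id}>\!\!>\!\!>f=f$;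 (2) $f>\!\!>\!\!>\mathtt{arr}\,\mathrm{id}=f$; (3) $(f>\!\!>\!\!>g)>\!\!>\!\!>h=f>\!\!>\!\!>(g>\!\!>\!\!>h)$; (4) $\mathtt{arr}(w\circ v)=\mathtt{arr}\,v>\!\!>\!\!>\mathtt{arr}\,w$; (5) $\mathtt{first}(\mathtt{arr}\,v)=\mathtt{arr}(v\times\mathrm{id})$; (6) $\mathtt{first}(f>\!\!>\!\!>g)=\mathtt{first}\,f>\!\!>\!\!>\mathtt{first}\,g$; (7) $\mathtt{first}\,f>\!\!>\!\!>\mathtt{arr}(\mathrm{id}\times v)=\mathtt{arr}(\mathrm{id}\times v)>\!\!>\!\!>\mathtt{first}\,f$; (8) $\mathtt{first}\,f>\!\!>\!\!>\mathtt{arr}\,\mathtt{fst}=\mathtt{arr}\,\mathtt{fst}>\!\!>\!\!>f$; (9) $\mathtt{first}(\mathtt{first}\,f)>\!\!>\!\!>\mathtt{arr}\,\mathtt{assoc}=\mathtt{arr}\,\mathtt{assoc}>\!\!>\!\!>\mathtt{first}\,f$; where $\mathtt{fst}:X\times Z\to X$ is the first projection and $\mathtt{assoc}:(X\times Y)\times Z\to X\times(Y\times Z)$ is the canonical associativity isomorphism of $C$. *)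

theory Defs
  imports Main
begin

section \<open>Categories and chosen finite products\<close>

record ('o, 'm) category =
  Obj :: "'o set"
  Mor :: "'m set"
  Dom :: "'m \<Rightarrow> 'o"
  Cod :: "'m \<Rightarrow> 'o"
  Id :: "'o \<Rightarrow> 'm"
  Comp :: "'m \<Rightarrow> 'm \<Rightarrow> 'm" (infixr "\<odot>\<index>" 70)

definition hom :: "('o, 'm, 'z) category_scheme \<Rightarrow> 'o \<Rightarrow> 'o \<Rightarrow> 'm set" where
  "hom K X Y = {f \<in> Mor K. Dom K f = X \<and> Cod K f = Y}"

locale category =
  fixes K :: "('o, 'm, 'z) category_scheme" (structure)
  assumes dom_obj: "f \<in> Mor K \<Longrightarrow> Dom K f \<in> Obj K"
    and cod_obj: "f \<in> Mor K \<Longrightarrow> Cod K f \<in> Obj K"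
    and id_hom: "X \<in> Obj K \<Longrightarrow> Id K X \<in> hom K X X"
    and comp_hom: "\<lbrakk>f \<in> hom K X Y; g \<in> hom K Y Z\<rbrakk> \<Longrightarrow> g \<odot> f \<in> hom K X Z"
    and comp_id_left: "f \<in> hom K X Y \<Longrightarrow> Id K Y \<odot> f = f"
    and comp_id_right: "f \<in> hom K X Y \<Longrightarrow> f \<odot> Id K X = f"
    and comp_assoc: "\<lbrakk>f \<in> hom K X Y; g \<in> hom K Y Z; h \<in> hom K Z W\<rbrakk>
      \<Longrightarrow> (h \<odot> g) \<odot> f = h \<odot> (g \<odot> f)"

definition is_terminal :: "('o, 'm, 'z) category_scheme \<Rightarrow> 'o \<Rightarrow> bool" where
  "is_terminal C t \<longleftrightarrow> t \<in> Obj C \<and> (\<forall>X \<in> Obj C. \<exists>!u. u \<in> hom C X t)"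

record ('o, 'm) cartesian = "('o, 'm) category" +
  One :: "'o"
  Prod :: "'o \<Rightarrow> 'o \<Rightarrow> 'o" (infixr "\<otimes>\<index>" 75)
  Fst :: "'o \<Rightarrow> 'o \<Rightarrow> 'm"
  Snd :: "'o \<Rightarrow> 'o \<Rightarrow> 'm"

locale cartesian_category = category C
  for C :: "('o, 'm, 'z) cartesian_scheme" (structure) +
  assumes one_terminal: "is_terminal C (One C)"
    and prod_obj: "\<lbrakk>X \<in> Obj C; Y \<in> Obj C\<rbrakk> \<Longrightarrow> X \<otimes> Y \<in> Obj C"
    and fst_hom: "\<lbrakk>X \<in> Obj C; Y \<in> Obj C\<rbrakk> \<Longrightarrow> Fst C X Y \<in> hom C (X \<otimes> Y) X"
    and snd_hom: "\<lbrakk>X \<in> Obj C; Y \<in> Obj C\<rbrakk> \<Longrightarrow> Snd C X Y \<in> hom C (X \<otimes> Y) Y"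
    and prod_universal: "\<lbrakk>v \<in> hom C Z X; w \<in> hom C Z Y\<rbrakk>
      \<Longrightarrow> \<exists>!h. h \<in> hom C Z (X \<otimes> Y) \<and> Fst C X Y \<odot> h = v \<and> Snd C X Y \<odot> h = w"

text \<open>Objects are recovered from domains and codomains, so \<open>pairing C v w\<close> is meaningful only
  for morphisms with a common domain; by \<open>prod_universal\<close> the description is then unique.\<close>

definition pairing :: "('o, 'm, 'z) cartesian_scheme \<Rightarrow> 'm \<Rightarrow> 'm \<Rightarrow> 'm" where
  "pairing C v w = (THE h. h \<in> hom C (Dom C v) (Cod C v \<otimes>\<^bsub>C\<^esub> Cod C w)
      \<and> Fst C (Cod C v) (Cod C w) \<odot>\<^bsub>C\<^esub> h = v
      \<and> Snd C (Cod C v) (Cod C w) \<odot>\<^bsub>C\<^esub> h = w)"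

definition prod_mor :: "('o, 'm, 'z) cartesian_scheme \<Rightarrow> 'm \<Rightarrow> 'm \<Rightarrow> 'm" where
  "prod_mor C v w = pairing C
      (v \<odot>\<^bsub>C\<^esub> Fst C (Dom C v) (Dom C w))
      (w \<odot>\<^bsub>C\<^esub> Snd C (Dom C v) (Dom C w))"

definition assoc_mor :: "('o, 'm, 'z) cartesian_scheme \<Rightarrow> 'o \<Rightarrow> 'o \<Rightarrow> 'o \<Rightarrow> 'm" where
  "assoc_mor C X Y Z = pairing C
      (Fst C X Y \<odot>\<^bsub>C\<^esub> Fst C (X \<otimes>\<^bsub>C\<^esub> Y) Z)
      (pairing C (Snd C X Y \<odot>\<^bsub>C\<^esub> Fst C (X \<otimes>\<^bsub>C\<^esub> Y) Z) (Snd C (X \<otimes>\<^bsub>C\<^esub> Y) Z))"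


section \<open>Effect categories\<close>

locale wide_subcategory = C: category C + K: category K
  for C :: "('o, 'm, 'c) category_scheme" and K :: "('o, 'm, 'k) category_scheme" +
  assumes same_obj: "Obj C = Obj K"
    and mor_subset: "Mor C \<subseteq> Mor K"
    and same_dom: "v \<in> Mor C \<Longrightarrow> Dom C v = Dom K v"
    and same_cod: "v \<in> Mor C \<Longrightarrow> Cod C v = Cod K v"
    and same_id: "X \<in> Obj C \<Longrightarrow> Id C X = Id K X"
    and same_comp: "\<lbrakk>v \<in> hom C X Y; w \<in> hom C Y Z\<rbrakk> \<Longrightarrow> w \<odot>\<^bsub>C\<^esub> v = w \<odot>\<^bsub>K\<^esub> v"

definition to_terminal :: "('o, 'm, 'c) category_scheme \<Rightarrow> 'o \<Rightarrow> 'o \<Rightarrow> 'm" where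
  "to_terminal C t X = (THE u. u \<in> hom C X t)"

definition effect ::
  "('o, 'm, 'c) category_scheme \<Rightarrow> ('o, 'm, 'k) category_scheme \<Rightarrow> 'o \<Rightarrow> 'm \<Rightarrow> 'm" where
  "effect C K t f = to_terminal C t (Cod K f) \<odot>\<^bsub>K\<^esub> f"

definition same_effect ::
  "('o, 'm, 'c) category_scheme \<Rightarrow> ('o, 'm, 'k) category_scheme \<Rightarrow> 'o \<Rightarrow> 'm \<Rightarrow> 'm \<Rightarrow> bool" where
  "same_effect C K t f f' \<longleftrightarrow> effect C K t f = effect C K t f'"

locale consistency_relation = wide_subcategory C K
  for C :: "('o, 'm, 'c) category_scheme" and K :: "('o, 'm, 'k) category_scheme" +
  fixes cons :: "'m \<Rightarrow> 'm \<Rightarrow> bool" (infix "\<lhd>" 50)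
  assumes cons_parallel_pure: "f \<lhd> v \<Longrightarrow> \<exists>X Y. f \<in> hom K X Y \<and> v \<in> hom C X Y"
    and cons_refl: "v \<in> Mor C \<Longrightarrow> v \<lhd> v"
    and cons_comp: "\<lbrakk>f \<in> hom K X Y; g \<in> hom K Y Z;
        u \<in> hom C Y Y'; v \<in> hom C X Y'; w \<in> hom C Y' Z;
        u \<odot>\<^bsub>K\<^esub> f \<lhd> v; g \<lhd> w \<odot>\<^bsub>K\<^esub> u\<rbrakk>
      \<Longrightarrow> g \<odot>\<^bsub>K\<^esub> f \<lhd> w \<odot>\<^bsub>K\<^esub> v"

definition consistent ::
  "('o, 'm, 'c) category_scheme \<Rightarrow> ('m \<Rightarrow> 'm \<Rightarrow> bool) \<Rightarrow> 'm \<Rightarrow> 'm \<Rightarrow> bool" where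
  "consistent C cons f f' \<longleftrightarrow> (\<exists>v \<in> Mor C. cons f v \<and> cons f' v)"

locale effect_category = consistency_relation C K cons
  for C :: "('o, 'm, 'c) category_scheme" and K :: "('o, 'm, 'k) category_scheme"
    and t :: 'o and cons :: "'m \<Rightarrow> 'm \<Rightarrow> bool" (infix "\<lhd>" 50) +
  assumes pure_terminal: "is_terminal C t"
    and complementarity: "\<lbrakk>f \<in> hom K X Y; f' \<in> hom K X Y;
        same_effect C K t f f'; consistent C cons f f'\<rbrakk> \<Longrightarrow> f = f'"

text \<open>The two semi-pure products are graph homomorphisms that act as \<open>\<otimes>\<close> on objects, so they are given
  by their action on morphisms. Here \<open>\<otimes>\<close> and the projections are those of \<open>C\<close>, while all
  composites are taken in \<open>K\<close>.\<close>

locale cartesian_effect_category = effect_category C K "One C" cons + cartesian_category C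
  for C :: "('o, 'm, 'c) cartesian_scheme" and K :: "('o, 'm, 'k) category_scheme"
    and cons :: "'m \<Rightarrow> 'm \<Rightarrow> bool" (infix "\<lhd>" 50) +
  fixes ltimes :: "'m \<Rightarrow> 'm \<Rightarrow> 'm" (infixr "\<ltimes>" 75)
    and rtimes :: "'m \<Rightarrow> 'm \<Rightarrow> 'm" (infixr "\<rtimes>" 75)
  assumes ltimes_hom: "\<lbrakk>v1 \<in> hom C X1 Y1; f2 \<in> hom K X2 Y2\<rbrakk>
      \<Longrightarrow> v1 \<ltimes> f2 \<in> hom K (X1 \<otimes>\<^bsub>C\<^esub> X2) (Y1 \<otimes>\<^bsub>C\<^esub> Y2)"
    and rtimes_hom: "\<lbrakk>f1 \<in> hom K X1 Y1; v2 \<in> hom C X2 Y2\<rbrakk>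
      \<Longrightarrow> f1 \<rtimes> v2 \<in> hom K (X1 \<otimes>\<^bsub>C\<^esub> X2) (Y1 \<otimes>\<^bsub>C\<^esub> Y2)"
    and ltimes_pure: "\<lbrakk>v1 \<in> Mor C; v2 \<in> Mor C\<rbrakk> \<Longrightarrow> v1 \<ltimes> v2 = prod_mor C v1 v2"
    and rtimes_pure: "\<lbrakk>v1 \<in> Mor C; v2 \<in> Mor C\<rbrakk> \<Longrightarrow> v1 \<rtimes> v2 = prod_mor C v1 v2"
    and ltimes_fst: "\<lbrakk>v1 \<in> hom C X1 Y1; f2 \<in> hom K X2 Y2\<rbrakk>
      \<Longrightarrow> Fst C Y1 Y2 \<odot>\<^bsub>K\<^esub> (v1 \<ltimes> f2) \<lhd> v1 \<odot>\<^bsub>K\<^esub> Fst C X1 X2"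
    and ltimes_snd: "\<lbrakk>v1 \<in> hom C X1 Y1; f2 \<in> hom K X2 Y2\<rbrakk>
      \<Longrightarrow> Snd C Y1 Y2 \<odot>\<^bsub>K\<^esub> (v1 \<ltimes> f2) = f2 \<odot>\<^bsub>K\<^esub> Snd C X1 X2"
    and ltimes_unique: "\<lbrakk>v1 \<in> hom C X1 Y1; f2 \<in> hom K X2 Y2;
        h \<in> hom K (X1 \<otimes>\<^bsub>C\<^esub> X2) (Y1 \<otimes>\<^bsub>C\<^esub> Y2);
        Fst C Y1 Y2 \<odot>\<^bsub>K\<^esub> h \<lhd> v1 \<odot>\<^bsub>K\<^esub> Fst C X1 X2;
        Snd C Y1 Y2 \<odot>\<^bsub>K\<^esub> h = f2 \<odot>\<^bsub>K\<^esub> Snd C X1 X2\<rbrakk>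
      \<Longrightarrow> h = v1 \<ltimes> f2"
    and rtimes_fst: "\<lbrakk>f1 \<in> hom K X1 Y1; v2 \<in> hom C X2 Y2\<rbrakk>
      \<Longrightarrow> Fst C Y1 Y2 \<odot>\<^bsub>K\<^esub> (f1 \<rtimes> v2) = f1 \<odot>\<^bsub>K\<^esub> Fst C X1 X2"
    and rtimes_snd: "\<lbrakk>f1 \<in> hom K X1 Y1; v2 \<in> hom C X2 Y2\<rbrakk>
      \<Longrightarrow> Snd C Y1 Y2 \<odot>\<^bsub>K\<^esub> (f1 \<rtimes> v2) \<lhd> v2 \<odot>\<^bsub>K\<^esub> Snd C X1 X2"
    and rtimes_unique: "\<lbrakk>f1 \<in> hom K X1 Y1; v2 \<in> hom C X2 Y2;
        h \<in> hom K (X1 \<otimes>\<^bsub>C\<^esub> X2) (Y1 \<otimes>\<^bsub>C\<^esub> Y2);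
        Fst C Y1 Y2 \<odot>\<^bsub>K\<^esub> h = f1 \<odot>\<^bsub>K\<^esub> Fst C X1 X2;
        Snd C Y1 Y2 \<odot>\<^bsub>K\<^esub> h \<lhd> v2 \<odot>\<^bsub>K\<^esub> Snd C X1 X2\<rbrakk>
      \<Longrightarrow> h = f1 \<rtimes> v2"


section \<open>Arrows\<close>

text \<open>The sets \<open>A X Y\<close> need not be disjoint, so the object indices of the operations,
  implicit in the usual notation, are explicit arguments here: \<open>arr X Y\<close> maps \<open>hom C X Y\<close>
  to \<open>A X Y\<close>, \<open>seq X Y Z\<close> maps \<open>A X Y\<close> and \<open>A Y Z\<close> to \<open>A X Z\<close>, and \<open>first X Y Z\<close> maps
  \<open>A X Y\<close> to \<open>A (X \<otimes> Z) (Y \<otimes> Z)\<close>.\<close>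

locale arrow = cartesian_category C
  for C :: "('o, 'm, 'z) cartesian_scheme" (structure) +
  fixes A :: "'o \<Rightarrow> 'o \<Rightarrow> 'a set"
    and arr :: "'o \<Rightarrow> 'o \<Rightarrow> 'm \<Rightarrow> 'a"
    and seq :: "'o \<Rightarrow> 'o \<Rightarrow> 'o \<Rightarrow> 'a \<Rightarrow> 'a \<Rightarrow> 'a"
    and first :: "'o \<Rightarrow> 'o \<Rightarrow> 'o \<Rightarrow> 'a \<Rightarrow> 'a"
  assumes arr_type: "\<lbrakk>X \<in> Obj C; Y \<in> Obj C; v \<in> hom C X Y\<rbrakk> \<Longrightarrow> arr X Y v \<in> A X Y"
    and seq_type: "\<lbrakk>X \<in> Obj C; Y \<in> Obj C; Z \<in> Obj C; f \<in> A X Y; g \<in> A Y Z\<rbrakk>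
      \<Longrightarrow> seq X Y Z f g \<in> A X Z"
    and first_type: "\<lbrakk>X \<in> Obj C; Y \<in> Obj C; Z \<in> Obj C; f \<in> A X Y\<rbrakk>
      \<Longrightarrow> first X Y Z f \<in> A (X \<otimes> Z) (Y \<otimes> Z)"
    and arr_id_seq: "\<lbrakk>X \<in> Obj C; Y \<in> Obj C; f \<in> A X Y\<rbrakk>
      \<Longrightarrow> seq X X Y (arr X X (Id C X)) f = f"
    and seq_arr_id: "\<lbrakk>X \<in> Obj C; Y \<in> Obj C; f \<in> A X Y\<rbrakk>
      \<Longrightarrow> seq X Y Y f (arr Y Y (Id C Y)) = f"
    and seq_assoc: "\<lbrakk>X \<in> Obj C; Y \<in> Obj C; Z \<in> Obj C; W \<in> Obj C;
        f \<in> A X Y; g \<in> A Y Z; h \<in> A Z W\<rbrakk>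
      \<Longrightarrow> seq X Z W (seq X Y Z f g) h = seq X Y W f (seq Y Z W g h)"
    and arr_comp: "\<lbrakk>X \<in> Obj C; Y \<in> Obj C; Z \<in> Obj C; v \<in> hom C X Y; w \<in> hom C Y Z\<rbrakk>
      \<Longrightarrow> arr X Z (w \<odot> v) = seq X Y Z (arr X Y v) (arr Y Z w)"
    and first_arr: "\<lbrakk>X \<in> Obj C; Y \<in> Obj C; Z \<in> Obj C; v \<in> hom C X Y\<rbrakk>
      \<Longrightarrow> first X Y Z (arr X Y v) = arr (X \<otimes> Z) (Y \<otimes> Z) (prod_mor C v (Id C Z))"
    and first_seq: "\<lbrakk>X \<in> Obj C; Y \<in> Obj C; Z \<in> Obj C; W \<in> Obj C; f \<in> A X Y; g \<in> A Y Z\<rbrakk>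
      \<Longrightarrow> first X Z W (seq X Y Z f g)
        = seq (X \<otimes> W) (Y \<otimes> W) (Z \<otimes> W) (first X Y W f) (first Y Z W g)"
    and first_natural: "\<lbrakk>X \<in> Obj C; Y \<in> Obj C; Z \<in> Obj C; W \<in> Obj C;
        f \<in> A X Y; v \<in> hom C Z W\<rbrakk>
      \<Longrightarrow> seq (X \<otimes> Z) (Y \<otimes> Z) (Y \<otimes> W)
            (first X Y Z f) (arr (Y \<otimes> Z) (Y \<otimes> W) (prod_mor C (Id C Y) v))
        = seq (X \<otimes> Z) (X \<otimes> W) (Y \<otimes> W)
            (arr (X \<otimes> Z) (X \<otimes> W) (prod_mor C (Id C X) v)) (first X Y W f)"
    and first_fst: "\<lbrakk>X \<in> Obj C; Y \<in> Obj C; Z \<in> Obj C; f \<in> A X Y\<rbrakk>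
      \<Longrightarrow> seq (X \<otimes> Z) (Y \<otimes> Z) Y (first X Y Z f) (arr (Y \<otimes> Z) Y (Fst C Y Z))
        = seq (X \<otimes> Z) X Y (arr (X \<otimes> Z) X (Fst C X Z)) f"
    and first_assoc: "\<lbrakk>X \<in> Obj C; Y \<in> Obj C; Z \<in> Obj C; W \<in> Obj C; f \<in> A X Y\<rbrakk>
      \<Longrightarrow> seq ((X \<otimes> Z) \<otimes> W) ((Y \<otimes> Z) \<otimes> W) (Y \<otimes> (Z \<otimes> W))
            (first (X \<otimes> Z) (Y \<otimes> Z) W (first X Y Z f))
            (arr ((Y \<otimes> Z) \<otimes> W) (Y \<otimes> (Z \<otimes> W)) (assoc_mor C Y Z W))
        = seq ((X \<otimes> Z) \<otimes> W) (X \<otimes> (Z \<otimes> W)) (Y \<otimes> (Z \<otimes> W))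
            (arr ((X \<otimes> Z) \<otimes> W) (X \<otimes> (Z \<otimes> W)) (assoc_mor C X Z W))
            (first X Y (Z \<otimes> W) f)"

end

theory Submission
  imports Defs
begin

text \<open>Every equation between morphisms into a product is reduced to the uniqueness of semi-pure
  products. For the associativity law, \<open>assoc \<circ> first (first f) = first f \<circ> assoc\<close> cannot be obtained
  this way directly, because no axiom yields consistency with a pure pairing from consistency of the
  two components. Instead one shows that \<open>assoc\<inverse> \<circ> first f \<circ> assoc\<close> satisfies the characterization
  of \<open>first (first f)\<close>: its first component is \<open>(id \<times> fst) \<circ> first f \<circ> assoc\<close>, which the naturality
  law of \<open>first\<close> turns into \<open>first f \<circ> fst\<close>.\<close>

section \<open>Pairings, products of morphisms and the associator\<close>

context cartesian_category
begin

lemma hom_obj: "f \<in> hom C X Y \<Longrightarrow> X \<in> Obj C \<and> Y \<in> Obj C"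
  using dom_obj cod_obj by (auto simp: hom_def)

text \<open>The domain and codomains of \<open>v\<close> and \<open>w\<close> recover
  \<open>Z\<close>, \<open>X\<close> and \<open>Y\<close>, so the description in
  \<open>pairing\<close> is the one that \<open>prod_universal\<close> makes unique. Later arguments
  use only these projections, never the description itself.\<close>

lemma pairing_universal:
  assumes "v \<in> hom C Z X" "w \<in> hom C Z Y"
  shows "pairing C v w \<in> hom C Z (X \<otimes> Y)
    \<and> Fst C X Y \<odot> pairing C v w = v \<and> Snd C X Y \<odot> pairing C v w = w"
proof -
  have "Dom C v = Z" "Cod C v = X" "Cod C w = Y"
    using assms by (auto simp: hom_def)
  then show ?thesis
    using theI'[OF prod_universal[OF assms]] by (simp add: pairing_def)
qed

lemmas pairing_hom = pairing_universal[THEN conjunct1]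
  and fst_pairing = pairing_universal[THEN conjunct2, THEN conjunct1]
  and snd_pairing = pairing_universal[THEN conjunct2, THEN conjunct2]

text \<open>The projections are jointly monic: both maps solve the same pairing problem, whose
  solution is unique. This settles the identities between pure maps below.\<close>

lemma prod_ext:
  assumes "h \<in> hom C Z (X \<otimes> Y)" "h' \<in> hom C Z (X \<otimes> Y)" "X \<in> Obj C" "Y \<in> Obj C"
    and "Fst C X Y \<odot> h = Fst C X Y \<odot> h'" "Snd C X Y \<odot> h = Snd C X Y \<odot> h'"
  shows "h = h'"
proof -
  have "Fst C X Y \<odot> h \<in> hom C Z X" "Snd C X Y \<odot> h \<in> hom C Z Y"
    by (rule comp_hom[OF assms(1) fst_hom[OF assms(3,4)]], rule comp_hom[OF assms(1) snd_hom[OF assms(3,4)]])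
  from prod_universal[OF this] show ?thesis
    using assms by metis
qed

lemma prod_mor_universal:
  assumes "v \<in> hom C X Y" "w \<in> hom C X' Y'"
  shows "prod_mor C v w \<in> hom C (X \<otimes> X') (Y \<otimes> Y')
    \<and> Fst C Y Y' \<odot> prod_mor C v w = v \<odot> Fst C X X'
    \<and> Snd C Y Y' \<odot> prod_mor C v w = w \<odot> Snd C X X'"
proof -
  have d: "Dom C v = X" "Dom C w = X'"
    using assms by (auto simp: hom_def)
  have "v \<odot> Fst C X X' \<in> hom C (X \<otimes> X') Y" "w \<odot> Snd C X X' \<in> hom C (X \<otimes> X') Y'"
    using comp_hom[OF fst_hom assms(1)] comp_hom[OF snd_hom assms(2)] hom_obj assms by blast+
  from pairing_universal[OF this] show ?thesis
    by (simp add: prod_mor_def d)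
qed

lemmas prod_mor_hom = prod_mor_universal[THEN conjunct1]
  and fst_prod_mor = prod_mor_universal[THEN conjunct2, THEN conjunct1]
  and snd_prod_mor = prod_mor_universal[THEN conjunct2, THEN conjunct2]

text \<open>The inverse associator. Its first component is written as a product map
  \<open>id \<times> fst\<close> instead of a nested pairing of projections, because this is the
  shape to which the naturality of \<open>first\<close> applies.\<close>

definition assoc_inv :: "'o \<Rightarrow> 'o \<Rightarrow> 'o \<Rightarrow> 'm" where
  "assoc_inv X Y Z = pairing C (prod_mor C (Id C X) (Fst C Y Z)) (Snd C Y Z \<odot> Snd C X (Y \<otimes> Z))"

context
  fixes X Y Z
  assumes obj: "X \<in> Obj C" "Y \<in> Obj C" "Z \<in> Obj C"
begin

private lemma tail_pairing_hom:
  "Snd C X Y \<odot> Fst C (X \<otimes> Y) Z \<in> hom C ((X \<otimes> Y) \<otimes> Z) Y"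
  "pairing C (Snd C X Y \<odot> Fst C (X \<otimes> Y) Z) (Snd C (X \<otimes> Y) Z) \<in> hom C ((X \<otimes> Y) \<otimes> Z) (Y \<otimes> Z)"
  "Fst C X Y \<odot> Fst C (X \<otimes> Y) Z \<in> hom C ((X \<otimes> Y) \<otimes> Z) X"
proof -
  show s: "Snd C X Y \<odot> Fst C (X \<otimes> Y) Z \<in> hom C ((X \<otimes> Y) \<otimes> Z) Y"
    and "Fst C X Y \<odot> Fst C (X \<otimes> Y) Z \<in> hom C ((X \<otimes> Y) \<otimes> Z) X"
    by (rule comp_hom[OF fst_hom snd_hom] comp_hom[OF fst_hom fst_hom]; intro obj prod_obj)+
  show "pairing C (Snd C X Y \<odot> Fst C (X \<otimes> Y) Z) (Snd C (X \<otimes> Y) Z) \<in> hom C ((X \<otimes> Y) \<otimes> Z) (Y \<otimes> Z)"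
    by (intro pairing_hom s snd_hom prod_obj obj)
qed

lemma assoc_hom: "assoc_mor C X Y Z \<in> hom C ((X \<otimes> Y) \<otimes> Z) (X \<otimes> (Y \<otimes> Z))"
  unfolding assoc_mor_def by (intro pairing_hom tail_pairing_hom)

lemma fst_assoc: "Fst C X (Y \<otimes> Z) \<odot> assoc_mor C X Y Z = Fst C X Y \<odot> Fst C (X \<otimes> Y) Z"
  unfolding assoc_mor_def by (rule fst_pairing[OF tail_pairing_hom(3,2)])

lemma snd_assoc:
  "Snd C X (Y \<otimes> Z) \<odot> assoc_mor C X Y Z
    = pairing C (Snd C X Y \<odot> Fst C (X \<otimes> Y) Z) (Snd C (X \<otimes> Y) Z)"
  unfolding assoc_mor_def by (rule snd_pairing[OF tail_pairing_hom(3,2)])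

text \<open>Together with \<open>fst_assoc\<close> and \<open>snd_snd_assoc\<close> this describes
  the associator by its projections onto \<open>X\<close>, \<open>Y\<close> and \<open>Z\<close>, so
  that its nested pairing need not be unfolded again.\<close>

lemma fst_snd_assoc:
  "Fst C Y Z \<odot> (Snd C X (Y \<otimes> Z) \<odot> assoc_mor C X Y Z) = Snd C X Y \<odot> Fst C (X \<otimes> Y) Z"
  unfolding snd_assoc by (rule fst_pairing[OF tail_pairing_hom(1) snd_hom]) (intro prod_obj obj)+

lemma snd_snd_assoc:
  "Snd C Y Z \<odot> (Snd C X (Y \<otimes> Z) \<odot> assoc_mor C X Y Z) = Snd C (X \<otimes> Y) Z"
  unfolding snd_assoc by (rule snd_pairing[OF tail_pairing_hom(1) snd_hom]) (intro prod_obj obj)+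

private lemma id_fst_hom: "prod_mor C (Id C X) (Fst C Y Z) \<in> hom C (X \<otimes> (Y \<otimes> Z)) (X \<otimes> Y)"
  by (intro prod_mor_hom id_hom fst_hom obj)

private lemma snd_snd_hom: "Snd C Y Z \<odot> Snd C X (Y \<otimes> Z) \<in> hom C (X \<otimes> (Y \<otimes> Z)) Z"
  by (rule comp_hom[OF snd_hom snd_hom]) (auto intro: obj prod_obj)

lemma assoc_inv_hom: "assoc_inv X Y Z \<in> hom C (X \<otimes> (Y \<otimes> Z)) ((X \<otimes> Y) \<otimes> Z)"
  unfolding assoc_inv_def by (intro pairing_hom id_fst_hom snd_snd_hom)

lemma fst_assoc_inv: "Fst C (X \<otimes> Y) Z \<odot> assoc_inv X Y Z = prod_mor C (Id C X) (Fst C Y Z)"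
  unfolding assoc_inv_def by (rule fst_pairing[OF id_fst_hom snd_snd_hom])

lemma snd_assoc_inv: "Snd C (X \<otimes> Y) Z \<odot> assoc_inv X Y Z = Snd C Y Z \<odot> Snd C X (Y \<otimes> Z)"
  unfolding assoc_inv_def by (rule snd_pairing[OF id_fst_hom snd_snd_hom])

text \<open>Both sides forget \<open>Z\<close> and keep \<open>X\<close> and \<open>Y\<close>, so
  they agree after each projection. In the associativity law this identity turns the pure map left
  over by naturality into the first projection.\<close>

lemma id_fst_assoc:
  "prod_mor C (Id C X) (Fst C Y Z) \<odot> assoc_mor C X Y Z = Fst C (X \<otimes> Y) Z"
proof (rule prod_ext)
  show "prod_mor C (Id C X) (Fst C Y Z) \<odot> assoc_mor C X Y Z \<in> hom C ((X \<otimes> Y) \<otimes> Z) (X \<otimes> Y)"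
    by (rule comp_hom[OF assoc_hom id_fst_hom])
  show "Fst C (X \<otimes> Y) Z \<in> hom C ((X \<otimes> Y) \<otimes> Z) (X \<otimes> Y)"
    by (intro fst_hom prod_obj obj)
  have "Fst C X Y \<odot> (prod_mor C (Id C X) (Fst C Y Z) \<odot> assoc_mor C X Y Z)
      = (Fst C X Y \<odot> prod_mor C (Id C X) (Fst C Y Z)) \<odot> assoc_mor C X Y Z"
    by (rule comp_assoc[symmetric, OF assoc_hom id_fst_hom fst_hom]) (auto intro: obj)
  also have "Fst C X Y \<odot> prod_mor C (Id C X) (Fst C Y Z) = Id C X \<odot> Fst C X (Y \<otimes> Z)"
    by (intro fst_prod_mor id_hom fst_hom obj)
  also have "\<dots> = Fst C X (Y \<otimes> Z)"
    by (rule comp_id_left[OF fst_hom]) (auto intro: obj prod_obj)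
  finally show "Fst C X Y \<odot> (prod_mor C (Id C X) (Fst C Y Z) \<odot> assoc_mor C X Y Z)
      = Fst C X Y \<odot> Fst C (X \<otimes> Y) Z"
    by (simp add: fst_assoc)
  have "Snd C X Y \<odot> (prod_mor C (Id C X) (Fst C Y Z) \<odot> assoc_mor C X Y Z)
      = (Snd C X Y \<odot> prod_mor C (Id C X) (Fst C Y Z)) \<odot> assoc_mor C X Y Z"
    by (rule comp_assoc[symmetric, OF assoc_hom id_fst_hom snd_hom]) (auto intro: obj)
  also have "Snd C X Y \<odot> prod_mor C (Id C X) (Fst C Y Z) = Fst C Y Z \<odot> Snd C X (Y \<otimes> Z)"
    by (intro snd_prod_mor id_hom fst_hom obj)
  also have "\<dots> \<odot> assoc_mor C X Y Z = Fst C Y Z \<odot> (Snd C X (Y \<otimes> Z) \<odot> assoc_mor C X Y Z)"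
    by (rule comp_assoc[OF assoc_hom snd_hom fst_hom]) (auto intro: obj prod_obj)
  finally show "Snd C X Y \<odot> (prod_mor C (Id C X) (Fst C Y Z) \<odot> assoc_mor C X Y Z)
      = Snd C X Y \<odot> Fst C (X \<otimes> Y) Z"
    by (simp add: fst_snd_assoc)
qed (fact obj)+

text \<open>This cancels the inverse associator once it has been introduced on the left of
  \<open>first f \<circ> assoc\<close>. The proof compares the projections onto \<open>X\<close>,
  \<open>Y\<close> and \<open>Z\<close>.\<close>

lemma assoc_assoc_inv: "assoc_mor C X Y Z \<odot> assoc_inv X Y Z = Id C (X \<otimes> (Y \<otimes> Z))"
proof -
  note ai = assoc_inv_hom
  have yz: "Y \<otimes> Z \<in> Obj C" and xy: "X \<otimes> Y \<in> Obj C" and xyz: "X \<otimes> (Y \<otimes> Z) \<in> Obj C"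
    by (intro prod_obj obj)+
  have hom: "assoc_mor C X Y Z \<odot> assoc_inv X Y Z \<in> hom C (X \<otimes> (Y \<otimes> Z)) (X \<otimes> (Y \<otimes> Z))"
    by (rule comp_hom[OF ai assoc_hom])
  have F: "Fst C X (Y \<otimes> Z) \<odot> (assoc_mor C X Y Z \<odot> assoc_inv X Y Z) = Fst C X (Y \<otimes> Z)"
  proof -
    have "Fst C X (Y \<otimes> Z) \<odot> (assoc_mor C X Y Z \<odot> assoc_inv X Y Z)
        = (Fst C X Y \<odot> Fst C (X \<otimes> Y) Z) \<odot> assoc_inv X Y Z"
      by (simp add: comp_assoc[symmetric, OF ai assoc_hom fst_hom[OF obj(1) yz]] fst_assoc)
    also have "\<dots> = Fst C X Y \<odot> prod_mor C (Id C X) (Fst C Y Z)"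
      by (simp add: comp_assoc[OF ai fst_hom[OF xy obj(3)] fst_hom[OF obj(1,2)]] fst_assoc_inv)
    also have "\<dots> = Fst C X (Y \<otimes> Z)"
      by (simp add: fst_prod_mor[OF id_hom[OF obj(1)] fst_hom[OF obj(2,3)]]
          comp_id_left[OF fst_hom[OF obj(1) yz]])
    finally show ?thesis .
  qed
  let ?s = "Snd C X (Y \<otimes> Z) \<odot> (assoc_mor C X Y Z \<odot> assoc_inv X Y Z)"
  have s: "?s = (Snd C X (Y \<otimes> Z) \<odot> assoc_mor C X Y Z) \<odot> assoc_inv X Y Z"
    by (rule comp_assoc[symmetric, OF ai assoc_hom snd_hom[OF obj(1) yz]])
  have sa: "Snd C X (Y \<otimes> Z) \<odot> assoc_mor C X Y Z \<in> hom C ((X \<otimes> Y) \<otimes> Z) (Y \<otimes> Z)"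
    by (rule comp_hom[OF assoc_hom snd_hom[OF obj(1) yz]])
  \<comment> \<open>The second component lands in a product again, so extensionality is applied a
    second time, to its components in \<open>Y\<close> and \<open>Z\<close>.\<close>
  have S: "?s = Snd C X (Y \<otimes> Z)"
  proof (rule prod_ext)
    show "?s \<in> hom C (X \<otimes> (Y \<otimes> Z)) (Y \<otimes> Z)"
      by (rule comp_hom[OF hom snd_hom[OF obj(1) yz]])
    show "Snd C X (Y \<otimes> Z) \<in> hom C (X \<otimes> (Y \<otimes> Z)) (Y \<otimes> Z)"
      by (rule snd_hom[OF obj(1) yz])
    have "Fst C Y Z \<odot> ?s = (Snd C X Y \<odot> Fst C (X \<otimes> Y) Z) \<odot> assoc_inv X Y Z"
      by (simp add: s comp_assoc[symmetric, OF ai sa fst_hom[OF obj(2,3)]] fst_snd_assoc)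
    also have "\<dots> = Snd C X Y \<odot> prod_mor C (Id C X) (Fst C Y Z)"
      by (simp add: comp_assoc[OF ai fst_hom[OF xy obj(3)] snd_hom[OF obj(1,2)]] fst_assoc_inv)
    also have "\<dots> = Fst C Y Z \<odot> Snd C X (Y \<otimes> Z)"
      by (rule snd_prod_mor[OF id_hom[OF obj(1)] fst_hom[OF obj(2,3)]])
    finally show "Fst C Y Z \<odot> ?s = Fst C Y Z \<odot> Snd C X (Y \<otimes> Z)" .
    show "Snd C Y Z \<odot> ?s = Snd C Y Z \<odot> Snd C X (Y \<otimes> Z)"
      by (simp add: s comp_assoc[symmetric, OF ai sa snd_hom[OF obj(2,3)]] snd_snd_assoc snd_assoc_inv)
  qed (fact obj)+
  show ?thesis
    by (rule prod_ext[OF hom id_hom[OF xyz] obj(1) yz])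
      (simp_all add: F S comp_id_right[OF fst_hom[OF obj(1) yz]] comp_id_right[OF snd_hom[OF obj(1) yz]])
qed

end

end

section \<open>Consistency under pure composition, and laws of the semi-pure product\<close>

context cartesian_effect_category
begin

lemma pure_hom: "v \<in> hom C X Y \<Longrightarrow> v \<in> hom K X Y"
  using mor_subset same_dom same_cod by (auto simp: hom_def)

lemma pure_mor: "v \<in> hom C X Y \<Longrightarrow> v \<in> Mor C"
  by (simp add: hom_def)

text \<open>The instance of \<open>cons_comp\<close> in which the intermediate pure map is the
  identity and the second morphism is the pure \<open>w\<close>, consistent with itself by
  \<open>cons_refl\<close>.\<close>

lemma cons_pure_left:
  assumes "f \<in> hom K X Y" "v \<in> hom C X Y" "w \<in> hom C Y Z" "f \<lhd> v"
  shows "w \<odot>\<^bsub>K\<^esub> f \<lhd> w \<odot>\<^bsub>K\<^esub> v"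
proof -
  have "Id C Y \<in> hom C Y Y"
    using hom_obj[OF assms(2)] C.id_hom by blast
  moreover have "Id C Y = Id K Y"
    using hom_obj[OF assms(2)] same_id by blast
  ultimately show ?thesis
    using cons_comp[OF assms(1) pure_hom[OF assms(3)] _ assms(2,3), of "Id C Y"]
      K.comp_id_left[OF assms(1)] K.comp_id_right[OF pure_hom[OF assms(3)]]
      cons_refl[OF pure_mor[OF assms(3)]] assms(4)
    by simp
qed

text \<open>Dual use of \<open>cons_comp\<close>: the intermediate map is again the identity, but
  now the first morphism is the pure \<open>u\<close>, consistent with itself.\<close>

lemma cons_pure_right:
  assumes "f \<in> hom K Y Z" "v \<in> hom C Y Z" "u \<in> hom C X Y" "f \<lhd> v"
  shows "f \<odot>\<^bsub>K\<^esub> u \<lhd> v \<odot>\<^bsub>K\<^esub> u"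
proof -
  have "Id C Y \<in> hom C Y Y"
    using hom_obj[OF assms(2)] C.id_hom by blast
  moreover have "Id C Y = Id K Y"
    using hom_obj[OF assms(2)] same_id by blast
  ultimately show ?thesis
    using cons_comp[OF pure_hom[OF assms(3)] assms(1) _ assms(3,2), of "Id C Y"]
      K.comp_id_left[OF pure_hom[OF assms(3)]] K.comp_id_right[OF pure_hom[OF assms(2)]]
      cons_refl[OF pure_mor[OF assms(3)]] assms(4)
    by simp
qed

text \<open>The composite of the two semi-pure products meets the characterization of the semi-pure
  product of the composites. Its first component follows by pasting two commuting squares, its
  second by pasting two squares that hold only up to consistency.\<close>

lemma rtimes_comp:
  assumes f: "f \<in> hom K X Y" and g: "g \<in> hom K Y Z"
    and v: "v \<in> hom C X' Y'" and w: "w \<in> hom C Y' Z'"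
  shows "(g \<odot>\<^bsub>K\<^esub> f) \<rtimes> (w \<odot>\<^bsub>K\<^esub> v) = (g \<rtimes> w) \<odot>\<^bsub>K\<^esub> (f \<rtimes> v)"
proof (rule rtimes_unique[symmetric])
  have obj: "X \<in> Obj C" "Y \<in> Obj C" "Z \<in> Obj C" "X' \<in> Obj C" "Y' \<in> Obj C" "Z' \<in> Obj C"
    using f g hom_obj[OF v] hom_obj[OF w] K.dom_obj K.cod_obj same_obj by (auto simp: hom_def)
  note fv = rtimes_hom[OF f v] and gw = rtimes_hom[OF g w]
  note p = fst_hom[OF obj(1,4)] snd_hom[OF obj(1,4)]
  note q = fst_hom[OF obj(2,5)] snd_hom[OF obj(2,5)]
  note r = fst_hom[OF obj(3,6)] snd_hom[OF obj(3,6)]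
  show "g \<odot>\<^bsub>K\<^esub> f \<in> hom K X Z"
    by (rule K.comp_hom[OF f g])
  show "w \<odot>\<^bsub>K\<^esub> v \<in> hom C X' Z'"
    using C.comp_hom[OF v w] by (simp add: same_comp[OF v w])
  show "(g \<rtimes> w) \<odot>\<^bsub>K\<^esub> (f \<rtimes> v) \<in> hom K (X \<otimes>\<^bsub>C\<^esub> X') (Z \<otimes>\<^bsub>C\<^esub> Z')"
    by (rule K.comp_hom[OF fv gw])
  have "Fst C Z Z' \<odot>\<^bsub>K\<^esub> ((g \<rtimes> w) \<odot>\<^bsub>K\<^esub> (f \<rtimes> v)) = (g \<odot>\<^bsub>K\<^esub> Fst C Y Y') \<odot>\<^bsub>K\<^esub> (f \<rtimes> v)"
    by (simp add: K.comp_assoc[symmetric, OF fv gw pure_hom[OF r(1)]] rtimes_fst[OF g w])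
  also have "\<dots> = g \<odot>\<^bsub>K\<^esub> (f \<odot>\<^bsub>K\<^esub> Fst C X X')"
    by (simp add: K.comp_assoc[OF fv pure_hom[OF q(1)] g] rtimes_fst[OF f v])
  also have "\<dots> = (g \<odot>\<^bsub>K\<^esub> f) \<odot>\<^bsub>K\<^esub> Fst C X X'"
    by (rule K.comp_assoc[symmetric, OF pure_hom[OF p(1)] f g])
  finally show "Fst C Z Z' \<odot>\<^bsub>K\<^esub> ((g \<rtimes> w) \<odot>\<^bsub>K\<^esub> (f \<rtimes> v)) = (g \<odot>\<^bsub>K\<^esub> f) \<odot>\<^bsub>K\<^esub> Fst C X X'" .
  have "v \<odot>\<^bsub>K\<^esub> Snd C X X' \<in> hom C (X \<otimes>\<^bsub>C\<^esub> X') Y'"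
    using C.comp_hom[OF p(2) v] by (simp add: same_comp[OF p(2) v])
  \<comment> \<open>The composition axiom is made for this pasting: its intermediate pure map is the
    projection \<open>Snd C Y Y'\<close> shared by the two squares.\<close>
  from cons_comp[OF fv K.comp_hom[OF gw pure_hom[OF r(2)]] q(2) this w
      rtimes_snd[OF f v] rtimes_snd[OF g w]]
  show "Snd C Z Z' \<odot>\<^bsub>K\<^esub> ((g \<rtimes> w) \<odot>\<^bsub>K\<^esub> (f \<rtimes> v)) \<lhd> (w \<odot>\<^bsub>K\<^esub> v) \<odot>\<^bsub>K\<^esub> Snd C X X'"
    by (simp add: K.comp_assoc[OF fv gw pure_hom[OF r(2)]]
        K.comp_assoc[OF pure_hom[OF p(2)] pure_hom[OF v] pure_hom[OF w]])
qed

text \<open>Both sides equal \<open>f \<rtimes> v\<close>. On pure pairs \<open>prod_mor\<close> is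
  a semi-pure product, so \<open>rtimes_comp\<close> merges the factors of each side and the
  identities disappear.\<close>

lemma rtimes_id_natural:
  assumes f: "f \<in> hom K X Y" and v: "v \<in> hom C Z W"
  shows "prod_mor C (Id C Y) v \<odot>\<^bsub>K\<^esub> (f \<rtimes> Id C Z) = (f \<rtimes> Id C W) \<odot>\<^bsub>K\<^esub> prod_mor C (Id C X) v"
proof -
  have obj: "X \<in> Obj C" "Y \<in> Obj C" "Z \<in> Obj C" "W \<in> Obj C"
    using f hom_obj[OF v] K.dom_obj K.cod_obj same_obj by (auto simp: hom_def)
  note i = C.id_hom[OF obj(1)] C.id_hom[OF obj(2)] C.id_hom[OF obj(3)] C.id_hom[OF obj(4)]
  have eq: "Id C Y \<odot>\<^bsub>K\<^esub> f = f" "f \<odot>\<^bsub>K\<^esub> Id C X = f" "v \<odot>\<^bsub>K\<^esub> Id C Z = v" "Id C W \<odot>\<^bsub>K\<^esub> v = v"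
    using K.comp_id_left K.comp_id_right f pure_hom[OF v] same_id obj by auto
  have "prod_mor C (Id C Y) v \<odot>\<^bsub>K\<^esub> (f \<rtimes> Id C Z) = (Id C Y \<rtimes> v) \<odot>\<^bsub>K\<^esub> (f \<rtimes> Id C Z)"
    using rtimes_pure pure_mor i v by metis
  also have "\<dots> = f \<rtimes> v"
    using rtimes_comp[OF f pure_hom[OF i(2)] i(3) v] eq by simp
  also have "\<dots> = (f \<rtimes> Id C W) \<odot>\<^bsub>K\<^esub> (Id C X \<rtimes> v)"
    using rtimes_comp[OF pure_hom[OF i(1)] f v i(4)] eq by simp
  also have "\<dots> = (f \<rtimes> Id C W) \<odot>\<^bsub>K\<^esub> prod_mor C (Id C X) v"
    using rtimes_pure pure_mor i v by metis
  finally show ?thesis .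
qed

text \<open>After composition with the inverse associator the codomain is
  \<open>(Y \<otimes> Z) \<otimes> W\<close>, where \<open>rtimes_unique\<close> asks for
  consistency in the single factor \<open>W\<close> and for an equation in
  \<open>Y \<otimes> Z\<close>. Neither condition requires pairing two consistency
  statements.\<close>

lemma rtimes_id_assoc:
  assumes f: "f \<in> hom K X Y" and zw: "Z \<in> Obj C" "W \<in> Obj C"
  shows "assoc_mor C Y Z W \<odot>\<^bsub>K\<^esub> ((f \<rtimes> Id C Z) \<rtimes> Id C W)
    = (f \<rtimes> Id C (Z \<otimes>\<^bsub>C\<^esub> W)) \<odot>\<^bsub>K\<^esub> assoc_mor C X Z W"
proof -
  have xy: "X \<in> Obj C" "Y \<in> Obj C"
    using f K.dom_obj K.cod_obj same_obj by (auto simp: hom_def)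
  note P = prod_obj
  define F where "F = f \<rtimes> Id C (Z \<otimes>\<^bsub>C\<^esub> W)"
  define a where "a = assoc_mor C X Z W"
  define b where "b = assoc_mor C Y Z W"
  define b' where "b' = assoc_inv Y Z W"
  have idzw: "Id C (Z \<otimes>\<^bsub>C\<^esub> W) \<in> hom C (Z \<otimes>\<^bsub>C\<^esub> W) (Z \<otimes>\<^bsub>C\<^esub> W)"
    by (intro C.id_hom P zw)
  have F: "F \<in> hom K (X \<otimes>\<^bsub>C\<^esub> (Z \<otimes>\<^bsub>C\<^esub> W)) (Y \<otimes>\<^bsub>C\<^esub> (Z \<otimes>\<^bsub>C\<^esub> W))"
    unfolding F_def by (rule rtimes_hom[OF f idzw])
  have aC: "a \<in> hom C ((X \<otimes>\<^bsub>C\<^esub> Z) \<otimes>\<^bsub>C\<^esub> W) (X \<otimes>\<^bsub>C\<^esub> (Z \<otimes>\<^bsub>C\<^esub> W))"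
    and bC: "b \<in> hom C ((Y \<otimes>\<^bsub>C\<^esub> Z) \<otimes>\<^bsub>C\<^esub> W) (Y \<otimes>\<^bsub>C\<^esub> (Z \<otimes>\<^bsub>C\<^esub> W))"
    and b'C: "b' \<in> hom C (Y \<otimes>\<^bsub>C\<^esub> (Z \<otimes>\<^bsub>C\<^esub> W)) ((Y \<otimes>\<^bsub>C\<^esub> Z) \<otimes>\<^bsub>C\<^esub> W)"
    unfolding a_def b_def b'_def by (intro assoc_hom assoc_inv_hom xy zw)+
  note a = pure_hom[OF aC] and b = pure_hom[OF bC] and b' = pure_hom[OF b'C]
  note Fa = K.comp_hom[OF a F]
  note fstY = fst_hom[OF P[OF xy(2) zw(1)] zw(2)] and sndY = snd_hom[OF P[OF xy(2) zw(1)] zw(2)]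
  have "b' \<odot>\<^bsub>K\<^esub> (F \<odot>\<^bsub>K\<^esub> a) = (f \<rtimes> Id C Z) \<rtimes> Id C W"
  proof (rule rtimes_unique)
    show fZ: "f \<rtimes> Id C Z \<in> hom K (X \<otimes>\<^bsub>C\<^esub> Z) (Y \<otimes>\<^bsub>C\<^esub> Z)"
      by (rule rtimes_hom[OF f C.id_hom[OF zw(1)]])
    show "Id C W \<in> hom C W W"
      by (rule C.id_hom[OF zw(2)])
    show "b' \<odot>\<^bsub>K\<^esub> (F \<odot>\<^bsub>K\<^esub> a) \<in> hom K ((X \<otimes>\<^bsub>C\<^esub> Z) \<otimes>\<^bsub>C\<^esub> W) ((Y \<otimes>\<^bsub>C\<^esub> Z) \<otimes>\<^bsub>C\<^esub> W)"
      by (rule K.comp_hom[OF Fa b'])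
    have m: "prod_mor C (Id C V) (Fst C Z W) \<in> hom C (V \<otimes>\<^bsub>C\<^esub> (Z \<otimes>\<^bsub>C\<^esub> W)) (V \<otimes>\<^bsub>C\<^esub> Z)"
      if "V \<in> Obj C" for V
      by (intro prod_mor_hom C.id_hom fst_hom that zw)
    have "Fst C (Y \<otimes>\<^bsub>C\<^esub> Z) W \<odot>\<^bsub>K\<^esub> (b' \<odot>\<^bsub>K\<^esub> (F \<odot>\<^bsub>K\<^esub> a))
        = prod_mor C (Id C Y) (Fst C Z W) \<odot>\<^bsub>K\<^esub> (F \<odot>\<^bsub>K\<^esub> a)"
      using fst_assoc_inv[OF xy(2) zw, folded b'_def]
      by (simp add: K.comp_assoc[symmetric, OF Fa b' pure_hom[OF fstY]]
          same_comp[OF b'C fstY, symmetric])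
    also have "\<dots> = (prod_mor C (Id C Y) (Fst C Z W) \<odot>\<^bsub>K\<^esub> F) \<odot>\<^bsub>K\<^esub> a"
      by (rule K.comp_assoc[symmetric, OF a F pure_hom[OF m[OF xy(2)]]])
    \<comment> \<open>Naturality at the pure projection \<open>Fst C Z W\<close> shrinks the factor
      carried along with \<open>f\<close> from \<open>Z \<otimes> W\<close> to
      \<open>Z\<close>.\<close>
    also have "\<dots> = ((f \<rtimes> Id C Z) \<odot>\<^bsub>K\<^esub> prod_mor C (Id C X) (Fst C Z W)) \<odot>\<^bsub>K\<^esub> a"
      by (simp add: F_def rtimes_id_natural[OF f fst_hom[OF zw]])
    also have "\<dots> = (f \<rtimes> Id C Z) \<odot>\<^bsub>K\<^esub> (prod_mor C (Id C X) (Fst C Z W) \<odot>\<^bsub>K\<^esub> a)"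
      by (rule K.comp_assoc[OF a pure_hom[OF m[OF xy(1)]] fZ])
    also have "\<dots> = (f \<rtimes> Id C Z) \<odot>\<^bsub>K\<^esub> Fst C (X \<otimes>\<^bsub>C\<^esub> Z) W"
      using id_fst_assoc[OF xy(1) zw, folded a_def] by (simp add: same_comp[OF aC m[OF xy(1)], symmetric])
    finally show "Fst C (Y \<otimes>\<^bsub>C\<^esub> Z) W \<odot>\<^bsub>K\<^esub> (b' \<odot>\<^bsub>K\<^esub> (F \<odot>\<^bsub>K\<^esub> a))
        = (f \<rtimes> Id C Z) \<odot>\<^bsub>K\<^esub> Fst C (X \<otimes>\<^bsub>C\<^esub> Z) W" .
    note sZW = snd_hom[OF zw]
    note sX = snd_hom[OF xy(1) P[OF zw]] and sY = snd_hom[OF xy(2) P[OF zw]]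
    have sYF: "Snd C Y (Z \<otimes>\<^bsub>C\<^esub> W) \<odot>\<^bsub>K\<^esub> F \<in> hom K (X \<otimes>\<^bsub>C\<^esub> (Z \<otimes>\<^bsub>C\<^esub> W)) (Z \<otimes>\<^bsub>C\<^esub> W)"
      by (rule K.comp_hom[OF F pure_hom[OF sY]])
    have "Snd C Y (Z \<otimes>\<^bsub>C\<^esub> W) \<odot>\<^bsub>K\<^esub> F \<lhd> Snd C X (Z \<otimes>\<^bsub>C\<^esub> W)"
      using rtimes_snd[OF f idzw] K.comp_id_left[OF pure_hom[OF sX]] same_id[OF P[OF zw]]
      by (simp add: F_def)
    \<comment> \<open>The consistency known for the whole factor \<open>Z \<otimes> W\<close> is
      precomposed with the associator and then projected to \<open>W\<close>; both maps are pure, so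
      it survives.\<close>
    from cons_pure_left[OF K.comp_hom[OF a sYF] _ sZW cons_pure_right[OF sYF sX aC this]]
    have c: "Snd C Z W \<odot>\<^bsub>K\<^esub> ((Snd C Y (Z \<otimes>\<^bsub>C\<^esub> W) \<odot>\<^bsub>K\<^esub> F) \<odot>\<^bsub>K\<^esub> a)
        \<lhd> Snd C Z W \<odot>\<^bsub>K\<^esub> (Snd C X (Z \<otimes>\<^bsub>C\<^esub> W) \<odot>\<^bsub>K\<^esub> a)"
      using C.comp_hom[OF aC sX] by (simp add: same_comp[OF aC sX])
    have "Snd C (Y \<otimes>\<^bsub>C\<^esub> Z) W \<odot>\<^bsub>K\<^esub> (b' \<odot>\<^bsub>K\<^esub> (F \<odot>\<^bsub>K\<^esub> a))
        = (Snd C Z W \<odot>\<^bsub>K\<^esub> Snd C Y (Z \<otimes>\<^bsub>C\<^esub> W)) \<odot>\<^bsub>K\<^esub> (F \<odot>\<^bsub>K\<^esub> a)"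
      using snd_assoc_inv[OF xy(2) zw, folded b'_def]
      by (simp add: K.comp_assoc[symmetric, OF Fa b' pure_hom[OF sndY]]
          same_comp[OF b'C sndY, symmetric] same_comp[OF sY sZW, symmetric])
    also have "\<dots> = Snd C Z W \<odot>\<^bsub>K\<^esub> ((Snd C Y (Z \<otimes>\<^bsub>C\<^esub> W) \<odot>\<^bsub>K\<^esub> F) \<odot>\<^bsub>K\<^esub> a)"
      by (simp add: K.comp_assoc[OF Fa pure_hom[OF sY] pure_hom[OF sZW]]
          K.comp_assoc[OF a F pure_hom[OF sY]])
    also note c
    also have "Snd C Z W \<odot>\<^bsub>K\<^esub> (Snd C X (Z \<otimes>\<^bsub>C\<^esub> W) \<odot>\<^bsub>K\<^esub> a) = Snd C (X \<otimes>\<^bsub>C\<^esub> Z) W"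
      using snd_snd_assoc[OF xy(1) zw, folded a_def] C.comp_hom[OF aC sX]
      by (simp add: same_comp[OF aC sX, symmetric] same_comp[OF _ sZW, symmetric])
    finally show "Snd C (Y \<otimes>\<^bsub>C\<^esub> Z) W \<odot>\<^bsub>K\<^esub> (b' \<odot>\<^bsub>K\<^esub> (F \<odot>\<^bsub>K\<^esub> a))
        \<lhd> Id C W \<odot>\<^bsub>K\<^esub> Snd C (X \<otimes>\<^bsub>C\<^esub> Z) W"
      using K.comp_id_left[OF pure_hom[OF snd_hom[OF P[OF xy(1) zw(1)] zw(2)]]] same_id[OF zw(2)]
      by simp
  qed
  \<comment> \<open>Composing the identity just proved with \<open>b\<close> cancels
    \<open>b'\<close> and leaves the law in its stated form.\<close>
  moreover have "b \<odot>\<^bsub>K\<^esub> (b' \<odot>\<^bsub>K\<^esub> (F \<odot>\<^bsub>K\<^esub> a)) = F \<odot>\<^bsub>K\<^esub> a"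
    using assoc_assoc_inv[OF xy(2) zw, folded b_def b'_def] K.comp_id_left[OF Fa] same_id[OF P[OF xy(2) P[OF zw]]]
    by (simp add: K.comp_assoc[symmetric, OF Fa b' b] same_comp[OF b'C bC, symmetric])
  ultimately show ?thesis
    by (simp add: F_def a_def b_def)
qed

text \<open>The laws for \<open>first\<close> are \<open>rtimes_pure\<close>,
  \<open>rtimes_comp\<close>, \<open>rtimes_id_natural\<close>, \<open>rtimes_fst\<close> and
  \<open>rtimes_id_assoc\<close>. The remaining laws are the category laws of \<open>K\<close>,
  transported along the agreement of identities and composition in \<open>C\<close> and
  \<open>K\<close>.\<close>

lemma arrow_of_effects:
  "arrow C (\<lambda>X Y. hom K X Y) (\<lambda>X Y v. v) (\<lambda>X Y Z f g. g \<odot>\<^bsub>K\<^esub> f) (\<lambda>X Y Z f. f \<rtimes> Id C Z)"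
proof unfold_locales
  \<comment> \<open>Functoriality of \<open>first\<close> needs the identity of \<open>W\<close>
    read as its own composite, so that \<open>rtimes_comp\<close> applies with identities on the
    pure side.\<close>
  fix X Y Z W f g
  assume "W \<in> Obj C" "f \<in> hom K X Y" "g \<in> hom K Y Z"
  then show "(g \<odot>\<^bsub>K\<^esub> f) \<rtimes> Id C W = (g \<rtimes> Id C W) \<odot>\<^bsub>K\<^esub> (f \<rtimes> Id C W)"
    using rtimes_comp[OF _ _ C.id_hom C.id_hom, of f X Y g Z W]
      K.comp_id_left[OF pure_hom[OF C.id_hom], of W] same_id[of W]
    by simp
next
  fix X Y f
  assume "X \<in> Obj C" "Y \<in> Obj C" "f \<in> hom K X Y"
  then show "f \<odot>\<^bsub>K\<^esub> Id C X = f" "Id C Y \<odot>\<^bsub>K\<^esub> f = f"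
    by (simp_all add: same_id K.comp_id_left K.comp_id_right)
qed (auto simp: same_comp pure_hom rtimes_fst[OF _ C.id_hom] rtimes_id_assoc
    rtimes_id_natural K.comp_assoc
    intro: K.comp_hom rtimes_hom C.id_hom rtimes_pure pure_mor)

end

theorem proposition17:
  fixes C :: "('o, 'm, 'c) cartesian_scheme"
    and K :: "('o, 'm, 'k) category_scheme"
    and cons :: "'m \<Rightarrow> 'm \<Rightarrow> bool"
    and ltimes rtimes :: "'m \<Rightarrow> 'm \<Rightarrow> 'm"
  assumes "cartesian_effect_category C K cons ltimes rtimes"
  shows "arrow C
      (\<lambda>X Y. hom K X Y)
      (\<lambda>X Y v. v)
      (\<lambda>X Y Z f g. g \<odot>\<^bsub>K\<^esub> f)
      (\<lambda>X Y Z f. rtimes f (Id C Z))"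
  using assms by (rule cartesian_effect_category.arrow_of_effects)

end
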